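(* Let $b\in\mathbb{C}$, let $\rho\in\mathbb{C}$ with $\operatorname{Re}(\rho)>0$, and let $z\in\mathbb{C}\setminus(-\infty,0]$. (i) For $\nu,c\in\mathbb{C}$ with $\operatorname{Re}(\nu)>-\tfrac32$, $\operatorname{Re}(c)>\tfrac12$, the function $g=g_\nu^{(b,c)}(z;\rho)$ satisfies $$(-4\nu^2-4\nu+6)z\frac{\partial^3g}{\partial z\,\partial\rho^2}+(-4\nu^2-4\nu+39)z^2\frac{\partial^4g}{\partial z^2\partial\rho^2}+28z^3\frac{\partial^5g}{\partial z^3\partial\rho^2}+4z^4\frac{\partial^6g}{\partial z^4\partial\rho^2}+(\nu^2+\nu)\frac{\partial^2g}{\partial\rho^2}=-4bz^2g .$$ (ii) For $\nu,\lambda\in\mathbb{C}$ with $\operatorname{Re}(\nu)>-1$, $\operatorname{Re}(\lambda)>0$, the function $C=C_\nu^{(b,\lambda)}(z;\rho)$ satisfies $$(\nu^3+4\nu^2+5\nu+2)\frac{\partial^3C}{\partial z\,\partial\rho^2}+(5\nu^2+21\nu+22)z\frac{\partial^4C}{\partial z^2\partial\rho^2}+(8\nu+22)z^2\frac{\partial^5C}{\partial z^3\partial\rho^2}+4z^3\frac{\partial^6C}{\partial z^4\partial\rho^2}=-bC .$$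
   Context: For $\rho\in\mathbb{C}$ with $\operatorname{Re}(\rho)>0$ and $x\in\mathbb{C}$ put $\Gamma_\rho(x)=\int_0^\infty t^{x-1}e^{-t-\rho/t}\,dt$. The generalized Pochhammer symbol is $(\lambda;\rho)_\nu:=\Gamma_\rho(\lambda+\nu)/\Gamma(\lambda)$ for $\lambda,\nu\in\mathbb{C}$. The unified four parameter Bessel function is $G_\nu^{(b,c)}(z;\rho):=\sum_{k=0}^\infty \frac{(-b)^k (c;\rho)_{2k+\nu}}{\Gamma(\nu+k+1)\,\Gamma(\nu+2k+1)}\,\frac{(z/2)^{2k+\nu}}{k!}$. The generalized four parameter spherical Bessel and Bessel-Clifford functions are $$g_\nu^{(b,c)}(z;\rho):=\sqrt{\tfrac{\pi}{2z}}\,G_{\nu+\frac12}^{(b,c-\frac12)}(z;\rho)=\frac{\sqrt\pi}{2}\sum_{k=0}^\infty\frac{(-b)^k(c-\frac12;\rho)_{2k+\nu+\frac12}}{k!\,\Gamma(\nu+k+\frac32)\,\Gamma(\nu+2k+\frac32)}\Big(\frac z2\Big)^{2k+\nu},$$ $$C_\nu^{(b,\lambda)}(z;\rho):=z^{-\nu/2}G_\nu^{(b,\lambda)}(2\sqrt z;\rho)=\sum_{k=0}^\infty\frac{(-b)^k(\lambda;\rho)_{2k+\nu}}{k!\,\Gamma(\nu+k+1)\,\Gamma(\nu+2k+1)}\,z^k.$$ Powers and square roots are principal. *)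

theory Defs
  imports "HOL-Complex_Analysis.Complex_Analysis"
begin

definition gen_Gamma :: "complex \<Rightarrow> complex \<Rightarrow> complex" where
  "gen_Gamma \<rho> x =
     (LBINT t:{0<..}. complex_of_real t powr (x - 1)
        * exp (- complex_of_real t - \<rho> / complex_of_real t))"

definition gen_poch :: "complex \<Rightarrow> complex \<Rightarrow> complex \<Rightarrow> complex" where
  "gen_poch a \<rho> \<nu> = gen_Gamma \<rho> (a + \<nu>) / Gamma a"

text \<open>
  The library's conventions \<open>Gamma x = 0\<close> at the poles and \<open>y / 0 = 0\<close> agree here with
  the usual reading of \<open>1 / Gamma\<close> as an entire function. The parameters come before
  the variables \<open>z\<close> and \<open>\<rho>\<close>, so that a partial application is a function of \<open>(z, \<rho>)\<close>.
\<close>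

definition unified_Bessel ::
    "complex \<Rightarrow> complex \<Rightarrow> complex \<Rightarrow> complex \<Rightarrow> complex \<Rightarrow> complex" where
  "unified_Bessel \<nu> b c z \<rho> =
     (\<Sum>k. (- b) ^ k * gen_poch c \<rho> (2 * of_nat k + \<nu>)
            / (Gamma (\<nu> + of_nat k + 1) * Gamma (\<nu> + 2 * of_nat k + 1))
            * ((z / 2) powr (2 * of_nat k + \<nu>) / fact k))"

definition spherical_Bessel ::
    "complex \<Rightarrow> complex \<Rightarrow> complex \<Rightarrow> complex \<Rightarrow> complex \<Rightarrow> complex" where
  "spherical_Bessel \<nu> b c z \<rho> =
     csqrt (of_real pi / (2 * z)) * unified_Bessel (\<nu> + 1 / 2) b (c - 1 / 2) z \<rho>"

definition Bessel_Clifford ::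
    "complex \<Rightarrow> complex \<Rightarrow> complex \<Rightarrow> complex \<Rightarrow> complex \<Rightarrow> complex" where
  "Bessel_Clifford \<nu> b a z \<rho> =
     z powr (- \<nu> / 2) * unified_Bessel \<nu> b a (2 * csqrt z) \<rho>"

text \<open>
  \<open>dz_drho2 j F z \<rho>\<close> is the mixed partial derivative of total order \<open>j + 2\<close>, taken twice in
  \<open>\<rho>\<close> first and then \<open>j\<close> times in \<open>z\<close>; both are complex derivatives.
\<close>

definition dz_drho2 ::
    "nat \<Rightarrow> (complex \<Rightarrow> complex \<Rightarrow> complex) \<Rightarrow> complex \<Rightarrow> complex \<Rightarrow> complex" where
  "dz_drho2 j F z \<rho> = (deriv ^^ j) (\<lambda>w. (deriv ^^ 2) (\<lambda>r. F w r) \<rho>) z"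

text \<open>
  Since \<open>deriv\<close> is total, that the derivatives occurring in \<open>dz_drho2\<close> exist has to be said
  separately: \<open>F\<close> is holomorphic in \<open>\<rho>\<close> on the right half-plane, and its second
  \<open>\<rho>\<close>-derivative is holomorphic in \<open>z\<close> on the slit plane.
\<close>

definition derivs_exist :: "(complex \<Rightarrow> complex \<Rightarrow> complex) \<Rightarrow> bool" where
  "derivs_exist F \<longleftrightarrow>
     (\<forall>w \<in> - \<real>\<^sub>\<le>\<^sub>0. (\<lambda>r. F w r) holomorphic_on {r. Re r > 0}) \<and>
     (\<forall>r. Re r > 0 \<longrightarrow> (\<lambda>w. (deriv ^^ 2) (\<lambda>s. F w s) r) holomorphic_on (- \<real>\<^sub>\<le>\<^sub>0))"

end

theory Submission
  imports Defs
begin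

text \<open>
  Both functions are series \<open>\<Sum>k. A k * \<Gamma>\<^sub>\<rho> (x + 2 k) * z powr (p k + \<mu>)\<close>, where up to constants
  \<open>A k\<close> is \<open>\<beta> ^ k / (k! \<Gamma> (\<nu> + k + 1) \<Gamma> (\<nu> + 2 k + 1))\<close>. Differentiating under the integral sign
  gives \<open>\<partial>\<Gamma>\<^sub>\<rho> x / \<partial>\<rho> = - \<Gamma>\<^sub>\<rho> (x - 1)\<close>, so two \<open>\<rho>\<close>-derivatives lower \<open>x + 2 k\<close> to
  \<open>x + 2 (k - 1)\<close>: the Gamma factor of the \<open>k\<close>-th term becomes that of its predecessor. The
  remaining quotient \<open>A k / A (k - 1)\<close> is \<open>\<beta>\<close> divided by a quartic polynomial in \<open>k\<close>. The differential
  operator in \<open>z\<close> multiplies \<open>z powr e\<close> by a quartic polynomial in \<open>e\<close>, and its coefficients are chosen so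
  that this polynomial at \<open>e = p k + \<mu>\<close> cancels the denominator and vanishes for \<open>k = 0\<close>. What is left is the
  original series, shifted by one index and multiplied by \<open>\<beta> z ^ p\<close>, up to a constant
  (\<open>gen_Gamma_series_ode\<close>).

  The analytic part is to justify the termwise derivatives. The estimate
  \<open>|\<Gamma>\<^sub>\<rho> (x + 2 k)| \<le> C (2 k + N)!\<close>, uniform for \<open>Re \<rho> \<ge> \<delta> > 0\<close> (\<open>norm_gen_Gamma_le\<close>), is
  overcome by the decay of \<open>A k\<close> (\<open>entire_against_fact_unified_Bessel_coeff\<close>). So the series converges locally
  uniformly in \<open>\<rho>\<close>, and for fixed \<open>\<rho>\<close> it is a principal power of \<open>z\<close> times an entire function of
  \<open>z ^ p\<close>.
\<close>

section \<open>The extended Gamma integral\<close>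

lemma power_exp_minus_integral:
  fixes n :: nat
  shows "set_integrable lborel {0<..} (\<lambda>t::real. t ^ n * exp (- t))"
    and "(LBINT t::real:{0<..}. t ^ n * exp (- t)) = fact n"
proof -
  have "(\<integral>\<^sup>+ t. ennreal (indicator {0<..} t *\<^sub>R (t ^ n * exp (- t))) \<partial>lborel) =
        (\<integral>\<^sup>+ t. ennreal (indicator {0..} t * t powr (real n + 1 - 1) / exp t) \<partial>lborel)"
  proof (rule nn_integral_cong_AE, use AE_lborel_singleton[of 0] in eventually_elim)
    case (elim t)
    then show ?case
      by (auto simp: indicator_def exp_minus powr_realpow field_simps)
  qed
  also have "\<dots> = ennreal (fact n)"
    by (subst Gamma_conv_nn_integral_real [symmetric])
       (auto simp: Gamma_fact add.commute)
  finally have *: "(\<integral>\<^sup>+ t. ennreal (indicator {0<..} t *\<^sub>R (t ^ n * exp (- t))) \<partial>lborel) = ennreal (fact n)" .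
  have "has_bochner_integral lborel (\<lambda>t::real. indicator {0<..} t *\<^sub>R (t ^ n * exp (- t))) (fact n)"
    by (rule has_bochner_integral_nn_integral) (use * in \<open>auto simp: indicator_def\<close>)
  then show "set_integrable lborel {0<..} (\<lambda>t::real. t ^ n * exp (- t))"
    and "(LBINT t::real:{0<..}. t ^ n * exp (- t)) = fact n"
    unfolding set_integrable_def set_lebesgue_integral_def by (simp_all only: has_bochner_integral_iff)
qed

text \<open>
  Near \<open>0\<close> the factor \<open>exp (- \<delta> / t)\<close> beats every negative power of \<open>t\<close>, since
  \<open>exp u \<ge> u ^ N / N!\<close>; for \<open>t \<ge> 1\<close> the power is at most \<open>t ^ N\<close>. So an arbitrary real
  exponent may be traded for a natural one.
\<close>

lemma powr_exp_reciprocal_le: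
  fixes y \<delta> :: real
  assumes "\<delta> > 0"
  shows "\<exists>C\<ge>0. \<exists>N. \<forall>t>0. t powr y * exp (- \<delta> / t) \<le> C * (1 + t ^ N)"
proof -
  define N where "N = nat \<lceil>\<bar>y\<bar>\<rceil>"
  have N: "\<bar>y\<bar> \<le> real N"
    unfolding N_def by linarith
  define C where "C = 1 + fact N / \<delta> ^ N"
  have "t powr y * exp (- \<delta> / t) \<le> C * (1 + t ^ N)" if t: "t > 0" for t
  proof (cases "t \<ge> 1")
    case True
    have "t powr y * exp (- \<delta> / t) \<le> t powr (real N) * 1"
      by (rule mult_mono) (use True N assms in \<open>auto intro!: powr_mono\<close>)
    also have "\<dots> = t ^ N"
      using t by (simp add: powr_realpow)
    also have "\<dots> \<le> C * (1 + t ^ N)"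
    proof -
      have "1 * t ^ N \<le> C * (1 + t ^ N)"
        by (rule mult_mono) (use t assms in \<open>auto simp: C_def\<close>)
      then show ?thesis by simp
    qed
    finally show ?thesis .
  next
    case False
    have "(\<delta> / t) ^ N / fact N \<le> exp (\<delta> / t)"
    proof -
      have "(\<Sum>k\<in>{N}. (\<delta> / t) ^ k /\<^sub>R fact k) \<le> (\<Sum>k. (\<delta> / t) ^ k /\<^sub>R fact k)"
        by (rule sum_le_suminf[OF summable_exp_generic]) (use assms t in auto)
      then show ?thesis by (simp add: exp_def divide_inverse mult.commute)
    qed
    then have *: "exp (- \<delta> / t) \<le> fact N * t ^ N / \<delta> ^ N"
      using assms t by (simp add: exp_minus field_simps power_divide)
    have "t powr y * exp (- \<delta> / t) \<le> t powr (- real N) * (fact N * t ^ N / \<delta> ^ N)"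
      by (rule mult_mono) (use False t N * assms in \<open>auto intro!: powr_mono'\<close>)
    also have "\<dots> = fact N / \<delta> ^ N"
      using t by (simp add: powr_minus powr_realpow field_simps)
    also have "\<dots> \<le> C * (1 + t ^ N)"
    proof -
      have "fact N / \<delta> ^ N * 1 \<le> C * (1 + t ^ N)"
        by (rule mult_mono) (use t assms in \<open>auto simp: C_def\<close>)
      then show ?thesis by simp
    qed
    finally show ?thesis .
  qed
  moreover have "C \<ge> 0"
    using assms by (simp add: C_def)
  ultimately show ?thesis by blast
qed

text \<open>
  All estimates of the integral go through this one domination: it yields integrability of the
  defining integrand, the growth of \<open>gen_Gamma \<rho> (x + 2 k)\<close> in \<open>k\<close>, and the remainder estimate
  behind the \<open>\<rho>\<close>-derivative. Shifting the exponent by \<open>2 k\<close> costs only a factorial, and \<open>C\<close> and \<open>N\<close>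
  depend on \<open>y\<close> and \<open>\<delta>\<close> alone.
\<close>

lemma kernel_integral_bound:
  fixes y \<delta> :: real
  assumes "\<delta> > 0"
  obtains C N where "C \<ge> 0"
    "\<And>k (f :: real \<Rightarrow> complex).
        set_borel_measurable lborel {0<..} f \<Longrightarrow>
        (\<And>t. t > 0 \<Longrightarrow> norm (f t) \<le> t powr (y + 2 * real k) * exp (- t - \<delta> / t)) \<Longrightarrow>
        set_integrable lborel {0<..} f \<and> norm (LBINT t:{0<..}. f t) \<le> C * fact (2 * k + N)"
proof -
  obtain C N where C: "C \<ge> 0" and
    CN: "\<And>t. t > 0 \<Longrightarrow> t powr y * exp (- \<delta> / t) \<le> C * (1 + t ^ N)"
    using powr_exp_reciprocal_le[OF assms] by metis
  have "set_integrable lborel {0<..} f \<and> norm (LBINT t:{0<..}. f t) \<le> 2 * C * fact (2 * k + N)"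
    if meas: "set_borel_measurable lborel {0<..} f" and
       le: "\<And>t. t > 0 \<Longrightarrow> norm (f t) \<le> t powr (y + 2 * real k) * exp (- t - \<delta> / t)"
    for k and f :: "real \<Rightarrow> complex"
  proof -
    define g where "g t = C * (t ^ (2 * k) * exp (- t) + t ^ (2 * k + N) * exp (- t))" for t :: real
    have fg: "norm (f t) \<le> g t" if t: "t > 0" for t
    proof -
      have "t powr (y + 2 * real k) = t powr y * t ^ (2 * k)"
        using t powr_realpow[of t "2 * k"] by (simp add: powr_add)
      then have "norm (f t) \<le> t powr y * t ^ (2 * k) * (exp (- t) * exp (- \<delta> / t))"
        using le[OF t] by (simp add: exp_add[symmetric])
      also have "\<dots> = (t powr y * exp (- \<delta> / t)) * (t ^ (2 * k) * exp (- t))"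
        by simp
      also have "\<dots> \<le> (C * (1 + t ^ N)) * (t ^ (2 * k) * exp (- t))"
        by (rule mult_right_mono) (use CN[OF t] t in auto)
      also have "\<dots> = g t"
        by (simp add: g_def algebra_simps power_add)
      finally show ?thesis .
    qed
    have g: "set_integrable lborel {0<..} g"
      unfolding g_def by (intro set_integrable_mult_right set_integral_add power_exp_minus_integral)
    have f: "set_integrable lborel {0<..} f"
      by (rule set_integrable_bound[OF g meas]) (auto intro!: AE_I2 order.trans[OF fg])
    have "norm (LBINT t:{0<..}. f t) \<le> (LBINT t:{0<..}. norm (f t))"
      by (rule set_integral_norm_bound[OF f])
    also have "\<dots> \<le> (LBINT t:{0<..}. g t)"
      by (rule set_integral_mono) (use f g fg in \<open>auto intro: set_integrable_norm\<close>)
    also have "\<dots> = C * (fact (2 * k) + fact (2 * k + N))"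
      unfolding g_def
      by (simp only: set_integral_mult_right set_integral_add power_exp_minus_integral)
    also have "\<dots> \<le> C * (2 * fact (2 * k + N))"
      using fact_mono[of "2 * k" "2 * k + N", where ?'a = real] by (intro mult_left_mono C) auto
    finally show ?thesis using f by simp
  qed
  note bound = this
  show ?thesis
  proof (rule that[of "2 * C" N])
    show "2 * C \<ge> 0" using C by simp
  qed (rule bound)
qed

definition gen_Gamma_integrand :: "complex \<Rightarrow> complex \<Rightarrow> real \<Rightarrow> complex" where
  "gen_Gamma_integrand \<rho> x t = complex_of_real t powr (x - 1)
      * exp (- complex_of_real t - \<rho> / complex_of_real t)"

lemma gen_Gamma_altdef: "gen_Gamma \<rho> x = (LBINT t:{0<..}. gen_Gamma_integrand \<rho> x t)"
  by (simp add: gen_Gamma_def gen_Gamma_integrand_def)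

lemma norm_gen_Gamma_integrand:
  "t > 0 \<Longrightarrow> norm (gen_Gamma_integrand \<rho> x t) = t powr (Re x - 1) * exp (- t - Re \<rho> / t)"
  by (simp add: gen_Gamma_integrand_def norm_mult norm_powr_real_powr Re_divide_of_real)

lemma set_borel_measurable_gen_Gamma_integrand:
  "set_borel_measurable lborel {0<..} (gen_Gamma_integrand \<rho> x)"
proof -
  have "continuous_on {0<..} (gen_Gamma_integrand \<rho> x)"
    unfolding gen_Gamma_integrand_def[abs_def]
    by (auto intro!: continuous_intros simp: complex_nonpos_Reals_iff)
  then show ?thesis
    unfolding set_borel_measurable_def
    by (auto intro: borel_measurable_continuous_on_indicator)
qed

text \<open>
  The bound is uniform in \<open>\<rho>\<close> on each half-plane \<open>Re \<rho> \<ge> \<delta>\<close>, as locally uniform convergence of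
  the series below demands.
\<close>

lemma norm_gen_Gamma_le:
  fixes x :: complex and \<delta> :: real
  assumes "\<delta> > 0"
  obtains C N where "C \<ge> 0"
    "\<And>k \<rho>. Re \<rho> \<ge> \<delta> \<Longrightarrow> norm (gen_Gamma \<rho> (x + 2 * of_nat k)) \<le> C * fact (2 * k + N)"
proof -
  obtain C N where C: "C \<ge> 0" and CN: "\<And>k (f :: real \<Rightarrow> complex).
        set_borel_measurable lborel {0<..} f \<Longrightarrow>
        (\<And>t. t > 0 \<Longrightarrow> norm (f t) \<le> t powr ((Re x - 1) + 2 * real k) * exp (- t - \<delta> / t)) \<Longrightarrow>
        set_integrable lborel {0<..} f \<and> norm (LBINT t:{0<..}. f t) \<le> C * fact (2 * k + N)"
    using kernel_integral_bound[OF assms, of "Re x - 1"] by metis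
  have "norm (gen_Gamma \<rho> (x + 2 * of_nat k)) \<le> C * fact (2 * k + N)" if "Re \<rho> \<ge> \<delta>" for k \<rho>
    unfolding gen_Gamma_altdef
  proof (rule conjunct2[OF CN])
    fix t :: real assume t: "t > 0"
    have "exp (- t - Re \<rho> / t) \<le> exp (- t - \<delta> / t)"
      using t that by (auto simp: divide_right_mono)
    then show "norm (gen_Gamma_integrand \<rho> (x + 2 * of_nat k) t)
        \<le> t powr (Re x - 1 + 2 * real k) * exp (- t - \<delta> / t)"
      using t by (simp add: norm_gen_Gamma_integrand algebra_simps)
  qed (rule set_borel_measurable_gen_Gamma_integrand)
  then show ?thesis using C that by blast
qed

lemma set_integrable_gen_Gamma_integrand:
  assumes "Re \<rho> > 0"
  shows "set_integrable lborel {0<..} (gen_Gamma_integrand \<rho> x)"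
proof -
  obtain C N where CN: "\<And>k (f :: real \<Rightarrow> complex).
        set_borel_measurable lborel {0<..} f \<Longrightarrow>
        (\<And>t. t > 0 \<Longrightarrow> norm (f t) \<le> t powr ((Re x - 1) + 2 * real k) * exp (- t - Re \<rho> / t)) \<Longrightarrow>
        set_integrable lborel {0<..} f \<and> norm (LBINT t:{0<..}. f t) \<le> C * fact (2 * k + N)"
    using kernel_integral_bound[OF assms, of "Re x - 1"] by metis
  show ?thesis
    by (rule conjunct1[OF CN[where k = 0]]) (auto simp: norm_gen_Gamma_integrand set_borel_measurable_gen_Gamma_integrand)
qed

lemma norm_exp_minus_linear_le:
  "norm (exp u - 1 - u) \<le> exp (norm u) * (norm u)\<^sup>2" for u :: complex
proof -
  have "norm (exp u - (1 + u)) \<le> exp \<bar>Re u\<bar> * (norm u)\<^sup>2"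
    using Taylor_exp[of u 1] by (simp add: power2_eq_square)
  also have "\<dots> \<le> exp (norm u) * (norm u)\<^sup>2"
    by (intro mult_right_mono) (auto simp: abs_Re_le_cmod)
  finally show ?thesis by (simp add: algebra_simps)
qed

text \<open>
  Differentiation under the integral sign, by a quadratic estimate. With \<open>u = - h / t\<close> the
  integrand at \<open>\<rho> + h\<close> is \<open>exp u\<close> times that at \<open>\<rho>\<close>, and the factor \<open>- 1 / t\<close> of the linear term lowers
  the argument \<open>x\<close> by one. The remainder \<open>exp u - 1 - u\<close> is at most
  \<open>exp (|h| / t) |h|\<^sup>2 / t\<^sup>2\<close>: its exponential is absorbed by spending half of
  \<open>Re \<rho>\<close>, its power \<open>1 / t\<^sup>2\<close> lowers the exponent \<open>Re x - 1\<close> to \<open>Re x - 3\<close>.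
\<close>

lemma has_field_derivative_gen_Gamma:
  assumes "Re \<rho> > 0"
  shows "((\<lambda>r. gen_Gamma r x) has_field_derivative (- gen_Gamma \<rho> (x - 1))) (at \<rho>)"
proof -
  define \<delta> where "\<delta> = Re \<rho> / 2"
  have \<delta>: "\<delta> > 0" using assms by (simp add: \<delta>_def)
  obtain C N where C: "C \<ge> 0" and CN: "\<And>k (f :: real \<Rightarrow> complex).
        set_borel_measurable lborel {0<..} f \<Longrightarrow>
        (\<And>t. t > 0 \<Longrightarrow> norm (f t) \<le> t powr ((Re x - 3) + 2 * real k) * exp (- t - \<delta> / t)) \<Longrightarrow>
        set_integrable lborel {0<..} f \<and> norm (LBINT t:{0<..}. f t) \<le> C * fact (2 * k + N)"
    using kernel_integral_bound[OF \<delta>, of "Re x - 3"] by metis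
  define K where "K = C * fact N"
  have bound: "norm ((gen_Gamma (\<rho> + h) x - gen_Gamma \<rho> x) / h + gen_Gamma \<rho> (x - 1)) \<le> K * norm h"
    if h: "h \<noteq> 0" "norm h < \<delta>" for h
  proof -
    have "\<bar>Re h\<bar> \<le> norm h" by (rule abs_Re_le_cmod)
    then have "Re (\<rho> + h) > 0" using h by (simp add: \<delta>_def)
    note int = set_integrable_gen_Gamma_integrand[OF this, of x]
      set_integrable_gen_Gamma_integrand[OF assms, of x]
      set_integrable_gen_Gamma_integrand[OF assms, of "x - 1"]
    define E where "E t = (gen_Gamma_integrand (\<rho> + h) x t - gen_Gamma_integrand \<rho> x t
        + h * gen_Gamma_integrand \<rho> (x - 1) t) / h\<^sup>2" for t
    have E_int: "set_integrable lborel {0<..} E"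
      unfolding E_def by (intro set_integrable_divide set_integral_add set_integral_diff
          set_integrable_mult_right int)
    have "(gen_Gamma (\<rho> + h) x - gen_Gamma \<rho> x + h * gen_Gamma \<rho> (x - 1)) / h\<^sup>2
        = (LBINT t:{0<..}. E t)"
      unfolding gen_Gamma_altdef E_def
      by (simp add: int set_integral_add set_integral_diff)
    also have "norm \<dots> \<le> C * fact (2 * 0 + N)"
    proof (rule conjunct2[OF CN])
      show "set_borel_measurable lborel {0<..} E"
        using E_int by (simp add: set_integrable_def set_borel_measurable_def)
      fix t :: real assume t: "t > 0"
      define T where "T = complex_of_real t"
      define u where "u = - h / T"
      have T: "T \<noteq> 0" "norm T = t" using t by (auto simp: T_def)
      have "gen_Gamma_integrand (\<rho> + h) x t = gen_Gamma_integrand \<rho> x t * exp u"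
        by (simp add: gen_Gamma_integrand_def u_def T_def exp_add[symmetric] add_divide_distrib diff_diff_eq)
      moreover have "h * gen_Gamma_integrand \<rho> (x - 1) t = - gen_Gamma_integrand \<rho> x t * u"
        using T by (simp add: gen_Gamma_integrand_def u_def powr_diff power2_eq_square flip: T_def)
      ultimately have "E t = gen_Gamma_integrand \<rho> x t * (exp u - 1 - u) / h\<^sup>2"
        by (simp add: E_def algebra_simps)
      then have "norm (E t) = t powr (Re x - 1) * exp (- t - Re \<rho> / t) * norm (exp u - 1 - u) / (norm h)\<^sup>2"
        using t by (simp add: norm_mult norm_divide norm_power norm_gen_Gamma_integrand)
      also have "\<dots> \<le> t powr (Re x - 1) * exp (- t - Re \<rho> / t) * (exp (norm u) * (norm u)\<^sup>2) / (norm h)\<^sup>2"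
        by (intro divide_right_mono mult_left_mono norm_exp_minus_linear_le) auto
      also have "norm u = norm h / t"
        using T by (simp add: u_def norm_divide)
      also have "t powr (Re x - 1) * exp (- t - Re \<rho> / t) * (exp (norm h / t) * (norm h / t)\<^sup>2) / (norm h)\<^sup>2
          = t powr (Re x - 3) * exp (- t - (Re \<rho> - norm h) / t)"
      proof -
        have "t powr (Re x - 1) = t powr (Re x - 3) * t\<^sup>2"
          using t powr_add[of t "Re x - 3" 2] by simp
        moreover have "exp (- t - Re \<rho> / t) * exp (norm h / t) = exp (- t - (Re \<rho> - norm h) / t)"
          by (simp add: exp_add[symmetric] diff_divide_distrib)
        ultimately show ?thesis
          using h t by (simp add: power_divide field_simps)
      qed
      also have "\<dots> \<le> t powr (Re x - 3) * exp (- t - \<delta> / t)"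
      proof -
        have "\<delta> \<le> Re \<rho> - norm h"
          using h by (simp add: \<delta>_def)
        then have "\<delta> / t \<le> (Re \<rho> - norm h) / t"
          using t by (intro divide_right_mono) auto
        then show ?thesis
          by (intro mult_left_mono) auto
      qed
      finally show "norm (E t) \<le> t powr ((Re x - 3) + 2 * real 0) * exp (- t - \<delta> / t)"
        by simp
    qed
    finally have "norm (gen_Gamma (\<rho> + h) x - gen_Gamma \<rho> x + h * gen_Gamma \<rho> (x - 1)) \<le> K * (norm h)\<^sup>2"
      using h by (simp add: K_def norm_divide norm_power field_simps)
    moreover have "(gen_Gamma (\<rho> + h) x - gen_Gamma \<rho> x) / h + gen_Gamma \<rho> (x - 1)
        = (gen_Gamma (\<rho> + h) x - gen_Gamma \<rho> x + h * gen_Gamma \<rho> (x - 1)) / h"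
      using h by (simp add: field_simps)
    ultimately show ?thesis
      using h by (simp add: norm_divide power2_eq_square field_simps)
  qed
  have "((\<lambda>h. (gen_Gamma (\<rho> + h) x - gen_Gamma \<rho> x) / h + gen_Gamma \<rho> (x - 1)) \<longlongrightarrow> 0) (at 0)"
  proof (rule Lim_null_comparison)
    show "\<forall>\<^sub>F h in at 0. norm ((gen_Gamma (\<rho> + h) x - gen_Gamma \<rho> x) / h + gen_Gamma \<rho> (x - 1)) \<le> K * norm h"
      unfolding eventually_at using \<delta> bound by (intro exI[of _ \<delta>]) auto
    show "((\<lambda>h. K * norm h) \<longlongrightarrow> 0) (at (0 :: complex))"
      by (auto intro!: tendsto_eq_intros)
  qed
  then have "((\<lambda>h. (gen_Gamma (\<rho> + h) x - gen_Gamma \<rho> x) / h + gen_Gamma \<rho> (x - 1) - gen_Gamma \<rho> (x - 1))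
      \<longlongrightarrow> 0 - gen_Gamma \<rho> (x - 1)) (at 0)"
    by (intro tendsto_intros)
  then show ?thesis
    by (simp add: DERIV_def)
qed

section \<open>Series of powers with a common shift\<close>

text \<open>
  The coefficients stay those of an entire function after multiplication by any factor of the
  growth of \<open>gen_Gamma \<rho> (x + 2 k)\<close>. Leaving \<open>N\<close> free makes the condition independent of \<open>x\<close>.
\<close>

definition entire_against_fact :: "(nat \<Rightarrow> complex) \<Rightarrow> bool" where
  "entire_against_fact A \<longleftrightarrow> (\<forall>N R. summable (\<lambda>k. norm (A k) * fact (2 * k + N) * R ^ k))"

text \<open>
  The falling factorial \<open>e (e - 1) \<dots> (e - j + 1)\<close>, which is the eigenvalue of
  \<open>z ^ j (d / dz) ^ j\<close> on \<open>z powr e\<close>.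
\<close>

definition falling :: "complex \<Rightarrow> nat \<Rightarrow> complex" where
  "falling e j = (\<Prod>i<j. e - of_nat i)"

definition exponent :: "nat \<Rightarrow> complex \<Rightarrow> nat \<Rightarrow> complex" where
  "exponent p \<mu> k = of_nat (p * k) + \<mu>"

definition entire_coeffs :: "(nat \<Rightarrow> complex) \<Rightarrow> bool" where
  "entire_coeffs d \<longleftrightarrow> (\<forall>R. summable (\<lambda>k. norm (d k) * R ^ k))"

lemma entire_coeffs_summable:
  assumes "entire_coeffs d"
  shows "summable (\<lambda>k. d k * y ^ k)"
proof (rule summable_norm_cancel)
  show "summable (\<lambda>k. norm (d k * y ^ k))"
    using assms unfolding entire_coeffs_def norm_mult norm_power by blast
qed

text \<open>
  A factor growing linearly in \<open>k\<close> is dominated by \<open>2 ^ k\<close>, which only doubles \<open>R\<close>.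
\<close>

lemma entire_coeffs_mult_exponent:
  assumes "entire_coeffs d"
  shows "entire_coeffs (\<lambda>k. d k * (exponent p \<mu> k - s))"
  unfolding entire_coeffs_def
proof
  fix R :: real
  show "summable (\<lambda>k. norm (d k * (exponent p \<mu> k - s)) * R ^ k)"
  proof (rule summable_comparison_test_ev)
    show "summable (\<lambda>k. (real p + norm (\<mu> - s)) * (norm (d k) * (2 * \<bar>R\<bar>) ^ k))"
      using assms unfolding entire_coeffs_def by (intro summable_mult) blast
    have "norm (norm (d k * (exponent p \<mu> k - s)) * R ^ k)
        \<le> (real p + norm (\<mu> - s)) * (norm (d k) * (2 * \<bar>R\<bar>) ^ k)" for k
    proof -
      have "norm (exponent p \<mu> k - s) \<le> norm (of_nat (p * k) :: complex) + norm (\<mu> - s)"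
        unfolding exponent_def by (metis add_diff_eq norm_triangle_ineq)
      also have "\<dots> = real p * real k + norm (\<mu> - s) * 1"
        by (simp add: norm_mult)
      also have "\<dots> \<le> real p * 2 ^ k + norm (\<mu> - s) * 2 ^ k"
        by (intro add_mono mult_left_mono) (auto simp: less_imp_le[OF of_nat_less_two_power])
      finally have "norm (exponent p \<mu> k - s) \<le> (real p + norm (\<mu> - s)) * 2 ^ k"
        by (simp add: algebra_simps)
      then have "norm (exponent p \<mu> k - s) * (norm (d k) * \<bar>R\<bar> ^ k)
          \<le> (real p + norm (\<mu> - s)) * 2 ^ k * (norm (d k) * \<bar>R\<bar> ^ k)"
        by (intro mult_right_mono) auto
      then show ?thesis
        by (simp add: norm_mult abs_mult power_abs power_mult_distrib mult_ac)
    qed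
    then show "\<forall>\<^sub>F k in sequentially. norm (norm (d k * (exponent p \<mu> k - s)) * R ^ k)
        \<le> (real p + norm (\<mu> - s)) * (norm (d k) * (2 * \<bar>R\<bar>) ^ k)"
      by (intro always_eventually allI)
  qed
qed

lemma entire_coeffs_mult_falling:
  "entire_coeffs d \<Longrightarrow> entire_coeffs (\<lambda>k. d k * falling (exponent p \<mu> k) j)"
proof (induction j)
  case (Suc j)
  have "entire_coeffs (\<lambda>k. d k * falling (exponent p \<mu> k) j * (exponent p \<mu> k - of_nat j))"
    by (rule entire_coeffs_mult_exponent[OF Suc.IH[OF Suc.prems]])
  then show ?case by (simp add: falling_def mult.assoc)
qed (simp add: falling_def)

lemma powr_exponent:
  assumes "z \<noteq> 0"
  shows "z powr (exponent p \<mu> k - s) = z powr (\<mu> - s) * (z ^ p) ^ k"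
proof -
  have "exponent p \<mu> k - s = (\<mu> - s) + of_nat (p * k)"
    by (simp add: exponent_def)
  then have "z powr (exponent p \<mu> k - s) = z powr (\<mu> - s) * z powr of_nat (p * k)"
    by (simp only: powr_add)
  then show ?thesis
    using assms by (simp only: powr_nat' power_mult simp_thms)
qed

lemma summable_powr_exponent:
  assumes "entire_coeffs d" "z \<noteq> 0"
  shows "summable (\<lambda>k. d k * z powr (exponent p \<mu> k - s))"
  using summable_mult[OF entire_coeffs_summable[OF assms(1), of "z ^ p"], of "z powr (\<mu> - s)"]
  by (simp add: powr_exponent[OF assms(2)] mult_ac)

text \<open>
  The series is \<open>z powr (\<mu> - s)\<close> times an entire function of \<open>z ^ p\<close>, so that the product rule
  and termwise differentiation of power series apply. The shift \<open>s\<close> makes the statement iterate: each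
  derivative is again a series of the same kind with \<open>s + 1\<close> for \<open>s\<close>.
\<close>

lemma has_field_derivative_powr_series:
  assumes d: "entire_coeffs d" and z: "z \<notin> \<real>\<^sub>\<le>\<^sub>0"
  shows "((\<lambda>z. \<Sum>k. d k * z powr (exponent p \<mu> k - s)) has_field_derivative
           (\<Sum>k. d k * (exponent p \<mu> k - s) * z powr (exponent p \<mu> k - (s + 1)))) (at z)"
proof -
  have z0: "z \<noteq> 0" using z by auto
  define h where "h y = (\<Sum>k. d k * y ^ k)" for y
  define h' where "h' y = (\<Sum>k. diffs d k * y ^ k)" for y
  have h: "(h has_field_derivative h' y) (at y)" for y
    unfolding h_def[abs_def] h'_def
    by (rule termdiffs_strong_converges_everywhere) (rule entire_coeffs_summable[OF d])
  have h'_sums: "(\<lambda>k. of_nat k * d k * y ^ (k - Suc 0)) sums h' y" for y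
    unfolding h'_def
    by (rule diffs_equiv, rule termdiff_converges_all, rule entire_coeffs_summable[OF d])
  have "((\<lambda>z. z powr (\<mu> - s) * h (z ^ p)) has_field_derivative
      ((\<mu> - s) * z powr (\<mu> - s - 1) * h (z ^ p)
        + z powr (\<mu> - s) * (h' (z ^ p) * (of_nat p * z ^ (p - 1))))) (at z)"
    using z by (auto intro!: derivative_eq_intros DERIV_chain2[OF h])
  moreover have "(\<mu> - s) * z powr (\<mu> - s - 1) * h (z ^ p)
        + z powr (\<mu> - s) * (h' (z ^ p) * (of_nat p * z ^ (p - 1)))
      = (\<Sum>k. d k * (exponent p \<mu> k - s) * z powr (exponent p \<mu> k - (s + 1)))"
  proof (rule sums_unique)
    have 1: "(\<lambda>k. (\<mu> - s) * z powr (\<mu> - s - 1) * (d k * (z ^ p) ^ k)) sums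
        ((\<mu> - s) * z powr (\<mu> - s - 1) * h (z ^ p))"
      unfolding h_def by (intro sums_mult summable_sums entire_coeffs_summable[OF d])
    have 2: "(\<lambda>k. z powr (\<mu> - s) * (of_nat p * z ^ (p - 1)) * (of_nat k * d k * (z ^ p) ^ (k - Suc 0))) sums
        (z powr (\<mu> - s) * (of_nat p * z ^ (p - 1)) * h' (z ^ p))"
      by (intro sums_mult h'_sums)
    have eq: "(\<mu> - s) * z powr (\<mu> - s - 1) * (d k * (z ^ p) ^ k)
          + z powr (\<mu> - s) * (of_nat p * z ^ (p - 1)) * (of_nat k * d k * (z ^ p) ^ (k - Suc 0))
        = d k * (exponent p \<mu> k - s) * z powr (exponent p \<mu> k - (s + 1))" for k
    proof -
      have a: "z powr (\<mu> - s) = z powr (\<mu> - s - 1) * z"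
        using z0 by (simp add: powr_diff)
      have b: "of_nat p * of_nat k * (z * z ^ (p - 1) * (z ^ p) ^ (k - Suc 0))
          = of_nat p * of_nat k * (z ^ p) ^ k"
        by (cases p; cases k) (auto simp: mult_ac)
      have "z powr (exponent p \<mu> k - (s + 1)) = z powr (\<mu> - s - 1) * (z ^ p) ^ k"
        using powr_exponent[OF z0, of p \<mu> k "s + 1"] by (simp add: diff_diff_eq)
      then have "d k * (exponent p \<mu> k - s) * z powr (exponent p \<mu> k - (s + 1))
          = z powr (\<mu> - s - 1) * d k * ((\<mu> - s) * (z ^ p) ^ k + of_nat p * of_nat k * (z ^ p) ^ k)"
        by (simp add: exponent_def algebra_simps)
      also have "\<dots> = z powr (\<mu> - s - 1) * d k * ((\<mu> - s) * (z ^ p) ^ k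
          + of_nat p * of_nat k * (z * z ^ (p - 1) * (z ^ p) ^ (k - Suc 0)))"
        by (simp only: b)
      finally show ?thesis
        unfolding a by (simp only: distrib_left mult_ac)
    qed
    show "(\<lambda>k. d k * (exponent p \<mu> k - s) * z powr (exponent p \<mu> k - (s + 1))) sums
        ((\<mu> - s) * z powr (\<mu> - s - 1) * h (z ^ p)
        + z powr (\<mu> - s) * (h' (z ^ p) * (of_nat p * z ^ (p - 1))))"
      using sums_add[OF 1 2] unfolding eq by (simp add: mult_ac)
  qed
  ultimately have D: "((\<lambda>z. z powr (\<mu> - s) * h (z ^ p)) has_field_derivative
      (\<Sum>k. d k * (exponent p \<mu> k - s) * z powr (exponent p \<mu> k - (s + 1)))) (at z)"
    by simp
  have ev: "\<forall>\<^sub>F z in nhds z. (\<Sum>k. d k * z powr (exponent p \<mu> k - s)) = z powr (\<mu> - s) * h (z ^ p)"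
  proof -
    have "\<forall>\<^sub>F z in nhds z. z \<in> - {0}"
      using z0 by (intro eventually_nhds_in_open) auto
    then show ?thesis
    proof eventually_elim
      case (elim w)
      then show ?case
        unfolding h_def by (subst suminf_mult[symmetric])
          (auto simp: powr_exponent mult_ac intro: entire_coeffs_summable[OF d])
    qed
  qed
  show ?thesis
    using DERIV_cong_ev[OF refl ev refl] D by simp
qed

lemma higher_deriv_powr_series:
  assumes d: "entire_coeffs d" and z: "z \<notin> \<real>\<^sub>\<le>\<^sub>0"
  shows "(deriv ^^ j) (\<lambda>z. \<Sum>k. d k * z powr exponent p \<mu> k) z
      = (\<Sum>k. d k * falling (exponent p \<mu> k) j * z powr (exponent p \<mu> k - of_nat j))"
  using z
proof (induction j arbitrary: z)
  case (Suc j)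
  let ?f = "\<lambda>z. \<Sum>k. d k * falling (exponent p \<mu> k) j * z powr (exponent p \<mu> k - of_nat j)"
  have "\<forall>\<^sub>F w in nhds z. w \<in> - \<real>\<^sub>\<le>\<^sub>0"
    using Suc.prems by (intro eventually_nhds_in_open) (auto simp: open_Compl)
  then have "\<forall>\<^sub>F w in nhds z. (deriv ^^ j) (\<lambda>z. \<Sum>k. d k * z powr exponent p \<mu> k) w = ?f w"
    by eventually_elim (use Suc.IH in auto)
  then have "(deriv ^^ Suc j) (\<lambda>z. \<Sum>k. d k * z powr exponent p \<mu> k) z = deriv ?f z"
    by (simp add: deriv_cong_ev)
  also have "\<dots> = (\<Sum>k. d k * falling (exponent p \<mu> k) j * (exponent p \<mu> k - of_nat j)
      * z powr (exponent p \<mu> k - (of_nat j + 1)))"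
    by (intro DERIV_imp_deriv has_field_derivative_powr_series entire_coeffs_mult_falling d Suc.prems)
  also have "\<dots> = (\<Sum>k. d k * falling (exponent p \<mu> k) (Suc j) * z powr (exponent p \<mu> k - of_nat (Suc j)))"
    by (simp add: falling_def mult_ac add.commute)
  finally show ?case .
qed (simp add: falling_def)

text \<open>
  Multiplication by \<open>z ^ j\<close> restores the original powers, so that derivatives of
  different orders can be combined term by term.
\<close>

lemma powr_series_euler_sums:
  assumes d: "entire_coeffs d" and z: "z \<notin> \<real>\<^sub>\<le>\<^sub>0"
  shows "(\<lambda>k. d k * falling (exponent p \<mu> k) j * z powr exponent p \<mu> k) sums
      (z ^ j * (deriv ^^ j) (\<lambda>z. \<Sum>k. d k * z powr exponent p \<mu> k) z)"
proof -
  have z0: "z \<noteq> 0" using z by auto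
  have "(\<lambda>k. z ^ j * (d k * falling (exponent p \<mu> k) j * z powr (exponent p \<mu> k - of_nat j))) sums
      (z ^ j * (deriv ^^ j) (\<lambda>z. \<Sum>k. d k * z powr exponent p \<mu> k) z)"
    unfolding higher_deriv_powr_series[OF assms]
    by (intro sums_mult summable_sums summable_powr_exponent entire_coeffs_mult_falling d z0)
  then show ?thesis
    using z0 by (simp add: powr_diff powr_nat' mult_ac)
qed

lemma entire_coeffs_mult_fact_growth:
  assumes A: "entire_against_fact A" and B: "\<And>k. norm (B k) \<le> C * fact (2 * k + N)" 
  shows "entire_coeffs (\<lambda>k. A k * B k)"
  unfolding entire_coeffs_def
proof
  fix R :: real
  show "summable (\<lambda>k. norm (A k * B k) * R ^ k)"
  proof (rule summable_comparison_test_ev)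
    show "summable (\<lambda>k. C * (norm (A k) * fact (2 * k + N) * \<bar>R\<bar> ^ k))"
      using A unfolding entire_against_fact_def by (intro summable_mult) blast
    have "norm (norm (A k * B k) * R ^ k) \<le> C * (norm (A k) * fact (2 * k + N) * \<bar>R\<bar> ^ k)" for k
      using mult_left_mono[OF B[of k], of "norm (A k) * \<bar>R\<bar> ^ k"]
      by (simp add: norm_mult abs_mult power_abs mult_ac)
    then show "\<forall>\<^sub>F k in sequentially. norm (norm (A k * B k) * R ^ k)
        \<le> C * (norm (A k) * fact (2 * k + N) * \<bar>R\<bar> ^ k)"
      by (intro always_eventually allI)
  qed
qed

lemma entire_coeffs_gen_Gamma:
  assumes A: "entire_against_fact A" and r: "Re \<rho> > 0"
  shows "entire_coeffs (\<lambda>k. A k * gen_Gamma \<rho> (x + 2 * of_nat k))"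
proof -
  obtain C N where "\<And>k r. Re r \<ge> Re \<rho> \<Longrightarrow> norm (gen_Gamma r (x + 2 * of_nat k)) \<le> C * fact (2 * k + N)"
    using norm_gen_Gamma_le[OF r, of x] by metis
  then show ?thesis
    by (intro entire_coeffs_mult_fact_growth[OF A]) auto
qed

section \<open>Series in the extended Gamma function\<close>

text \<open>
  The common shape of the two functions: \<open>p = 2\<close>, \<open>\<mu> = \<nu>\<close> gives the spherical Bessel function and
  \<open>p = 1\<close>, \<open>\<mu> = 0\<close> the Bessel-Clifford function, with suitable \<open>A\<close> and \<open>x\<close>.
\<close>

definition gen_Gamma_series ::
    "(nat \<Rightarrow> complex) \<Rightarrow> complex \<Rightarrow> nat \<Rightarrow> complex \<Rightarrow> complex \<Rightarrow> complex \<Rightarrow> complex" where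
  "gen_Gamma_series A x p \<mu> z \<rho> =
     (\<Sum>k. A k * gen_Gamma \<rho> (x + 2 * of_nat k) * z powr exponent p \<mu> k)"

text \<open>
  The differentiated series converges uniformly on \<open>Re w > Re \<rho> / 2\<close> by the Weierstrass test,
  because \<open>norm_gen_Gamma_le\<close> bounds the Gamma factors by factorials independently of \<open>w\<close>.
\<close>

lemma has_field_derivative_gen_Gamma_series:
  assumes A: "entire_against_fact A" and r: "Re \<rho> > 0" and z: "z \<noteq> 0"
  shows "(gen_Gamma_series A x p \<mu> z has_field_derivative - gen_Gamma_series A (x - 1) p \<mu> z \<rho>) (at \<rho>)"
proof -
  define \<delta> where "\<delta> = Re \<rho> / 2"
  have \<delta>: "\<delta> > 0" using r by (simp add: \<delta>_def)
  define S where "S = {w. Re w > \<delta>}"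
  have S: "convex S" "open S" "\<rho> \<in> S"
    unfolding S_def using r convex_halfspace_Re_gt[of \<delta>] open_halfspace_Re_gt[of \<delta>]
    by (simp_all add: \<delta>_def)
  obtain C N where CN: "\<And>k r. Re r \<ge> \<delta> \<Longrightarrow>
      norm (gen_Gamma r (x - 1 + 2 * of_nat k)) \<le> C * fact (2 * k + N)"
    using norm_gen_Gamma_le[OF \<delta>, of "x - 1"] by metis
  let ?f = "\<lambda>k r. A k * gen_Gamma r (x + 2 * of_nat k) * z powr exponent p \<mu> k"
  let ?f' = "\<lambda>k r. A k * (- gen_Gamma r (x - 1 + 2 * of_nat k)) * z powr exponent p \<mu> k"
  have "((\<lambda>r. \<Sum>k. ?f k r) has_field_derivative (\<Sum>k. ?f' k \<rho>)) (at \<rho>)"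
  proof (rule has_field_derivative_series'(2)[where S = S and x0 = \<rho>])
    show "(?f k has_field_derivative ?f' k w) (at w within S)" if "w \<in> S" for k w
    proof -
      have "Re w > 0" using that \<delta> by (simp add: S_def)
      note * = has_field_derivative_gen_Gamma[OF this, of "x + 2 * of_nat k"]
      have **: "x + 2 * of_nat k - 1 = x - 1 + 2 * of_nat k" by simp
      show ?thesis
        by (intro DERIV_cmult DERIV_cmult_right has_field_derivative_at_within[OF *[unfolded **]])
    qed
    show "uniformly_convergent_on S (\<lambda>n w. \<Sum>k<n. ?f' k w)"
    proof (rule Weierstrass_m_test'_ev[OF always_eventually])
      show "\<forall>k. \<forall>w\<in>S. norm (?f' k w) \<le> norm (A k) * fact (2 * k + N) * norm (z ^ p) ^ k * (C * norm (z powr \<mu>))"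
      proof (intro allI ballI)
        fix k w assume "w \<in> S"
        then have "norm (gen_Gamma w (x - 1 + 2 * of_nat k)) \<le> C * fact (2 * k + N)"
          by (intro CN) (auto simp: S_def)
        from mult_left_mono[OF this, of "norm (A k) * norm (z powr \<mu> * (z ^ p) ^ k)"]
        show "norm (?f' k w) \<le> norm (A k) * fact (2 * k + N) * norm (z ^ p) ^ k * (C * norm (z powr \<mu>))"
          using powr_exponent[OF z, of p \<mu> k 0] by (simp add: norm_mult norm_power mult_ac)
      qed
      show "summable (\<lambda>k. norm (A k) * fact (2 * k + N) * norm (z ^ p) ^ k * (C * norm (z powr \<mu>)))"
        using A unfolding entire_against_fact_def by (intro summable_mult2) blast
    qed
    show "summable (\<lambda>k. ?f k \<rho>)"
      using summable_powr_exponent[OF entire_coeffs_gen_Gamma[OF A r] z, of x p \<mu> 0] by simp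
  qed (use S in \<open>auto simp: interior_open\<close>)
  moreover have "(\<Sum>k. ?f' k \<rho>) = - gen_Gamma_series A (x - 1) p \<mu> z \<rho>"
    unfolding gen_Gamma_series_def
    using summable_powr_exponent[OF entire_coeffs_gen_Gamma[OF A r] z, of "x - 1" p \<mu> 0]
    by (simp add: suminf_minus)
  ultimately show ?thesis by (simp add: gen_Gamma_series_def[abs_def])
qed

lemma higher_deriv_2_gen_Gamma_series:
  assumes A: "entire_against_fact A" and r: "Re \<rho> > 0" and z: "z \<noteq> 0"
  shows "(deriv ^^ 2) (gen_Gamma_series A x p \<mu> z) \<rho> = gen_Gamma_series A (x - 2) p \<mu> z \<rho>"
proof -
  have D: "(gen_Gamma_series A y p \<mu> z has_field_derivative - gen_Gamma_series A (y - 1) p \<mu> z s) (at s)"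
    if "Re s > 0" for y s
    using that by (rule has_field_derivative_gen_Gamma_series[OF A _ z])
  have "\<forall>\<^sub>F s in nhds \<rho>. s \<in> {s. Re s > 0}"
    using r by (intro eventually_nhds_in_open) (auto simp: open_halfspace_Re_gt)
  then have "\<forall>\<^sub>F s in nhds \<rho>. deriv (gen_Gamma_series A x p \<mu> z) s = - gen_Gamma_series A (x - 1) p \<mu> z s"
    by eventually_elim (auto intro: DERIV_imp_deriv[OF D])
  then have "deriv (deriv (gen_Gamma_series A x p \<mu> z)) \<rho> = deriv (\<lambda>s. - gen_Gamma_series A (x - 1) p \<mu> z s) \<rho>"
    by (intro deriv_cong_ev) auto
  also have "\<dots> = gen_Gamma_series A (x - 2) p \<mu> z \<rho>"
    by (rule DERIV_imp_deriv) (use DERIV_minus[OF D[OF r, of "x - 1"]] in simp)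
  finally show ?thesis by (simp add: eval_nat_numeral)
qed

lemma higher_deriv_2_eq_gen_Gamma_series:
  assumes A: "entire_against_fact A" and r: "Re \<rho> > 0" and z: "z \<notin> \<real>\<^sub>\<le>\<^sub>0"
    and F: "\<And>w r. w \<notin> \<real>\<^sub>\<le>\<^sub>0 \<Longrightarrow> Re r > 0 \<Longrightarrow> F w r = gen_Gamma_series A x p \<mu> w r"
  shows "(deriv ^^ 2) (F z) \<rho> = gen_Gamma_series A (x - 2) p \<mu> z \<rho>"
proof -
  have "\<forall>\<^sub>F s in nhds \<rho>. s \<in> {s. Re s > 0}"
    using r by (intro eventually_nhds_in_open) (auto simp: open_halfspace_Re_gt)
  then have "\<forall>\<^sub>F s in nhds \<rho>. F z s = gen_Gamma_series A x p \<mu> z s"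
    by eventually_elim (use F z in auto)
  then have "(deriv ^^ 2) (F z) \<rho> = (deriv ^^ 2) (gen_Gamma_series A x p \<mu> z) \<rho>"
    by (rule higher_deriv_cong_ev) simp
  then show ?thesis
    using higher_deriv_2_gen_Gamma_series[OF A r, of z x p \<mu>] z by (cases "z = 0") auto
qed

text \<open>
  The identity for \<open>F\<close> is demanded only where it can be expected: for \<open>Re r \<le> 0\<close> the integrals
  need not converge, and on the cut the principal powers on the two sides need not agree.
\<close>

lemma derivs_exist_gen_Gamma_series:
  assumes A: "entire_against_fact A"
    and F: "\<And>w r. w \<notin> \<real>\<^sub>\<le>\<^sub>0 \<Longrightarrow> Re r > 0 \<Longrightarrow> F w r = gen_Gamma_series A x p \<mu> w r"
  shows "derivs_exist F"
  unfolding derivs_exist_def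
proof (intro conjI ballI allI impI)
  fix w :: complex assume w: "w \<in> - \<real>\<^sub>\<le>\<^sub>0"
  then have "w \<noteq> 0" by auto
  then have "(gen_Gamma_series A x p \<mu> w) holomorphic_on {r. Re r > 0}"
    unfolding holomorphic_on_def field_differentiable_def
    using has_field_derivative_gen_Gamma_series[OF A] by (blast intro: has_field_derivative_at_within)
  then show "(\<lambda>r. F w r) holomorphic_on {r. Re r > 0}"
    by (rule holomorphic_transform) (use F w in auto)
next
  fix r :: complex assume r: "Re r > 0"
  have "(\<lambda>w. gen_Gamma_series A (x - 2) p \<mu> w r) holomorphic_on - \<real>\<^sub>\<le>\<^sub>0"
    unfolding gen_Gamma_series_def holomorphic_on_def field_differentiable_def
  proof (intro ballI exI)
    fix w :: complex assume "w \<in> - \<real>\<^sub>\<le>\<^sub>0"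
    then have "w \<notin> \<real>\<^sub>\<le>\<^sub>0" by simp
    from has_field_derivative_powr_series[OF entire_coeffs_gen_Gamma[OF A r] this, of "x - 2" p \<mu> 0]
    show "((\<lambda>w. \<Sum>k. A k * gen_Gamma r (x - 2 + 2 * of_nat k) * w powr exponent p \<mu> k)
        has_field_derivative (\<Sum>k. A k * gen_Gamma r (x - 2 + 2 * of_nat k) * exponent p \<mu> k
          * w powr (exponent p \<mu> k - 1))) (at w within - \<real>\<^sub>\<le>\<^sub>0)"
      by (auto intro: has_field_derivative_at_within)
  qed
  then show "(\<lambda>w. (deriv ^^ 2) (\<lambda>s. F w s) r) holomorphic_on - \<real>\<^sub>\<le>\<^sub>0"
    by (rule holomorphic_transform)
       (auto simp: higher_deriv_2_eq_gen_Gamma_series[OF A r _ F])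
qed

lemma dz_drho2_sums:
  assumes A: "entire_against_fact A" and r: "Re \<rho> > 0" and z: "z \<notin> \<real>\<^sub>\<le>\<^sub>0"
    and F: "\<And>w r. w \<notin> \<real>\<^sub>\<le>\<^sub>0 \<Longrightarrow> Re r > 0 \<Longrightarrow> F w r = gen_Gamma_series A x p \<mu> w r"
  shows "(\<lambda>k. A k * gen_Gamma \<rho> (x - 2 + 2 * of_nat k) * falling (exponent p \<mu> k) j
            * z powr exponent p \<mu> k) sums (z ^ j * dz_drho2 j F z \<rho>)"
proof -
  have "\<forall>\<^sub>F w in nhds z. w \<in> - \<real>\<^sub>\<le>\<^sub>0"
    using z by (intro eventually_nhds_in_open) (auto simp: open_Compl)
  then have "\<forall>\<^sub>F w in nhds z. (deriv ^^ 2) (\<lambda>r. F w r) \<rho> = gen_Gamma_series A (x - 2) p \<mu> w \<rho>"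
    by eventually_elim (auto simp: higher_deriv_2_eq_gen_Gamma_series[OF A r _ F])
  then have "dz_drho2 j F z \<rho> = (deriv ^^ j) (\<lambda>w. gen_Gamma_series A (x - 2) p \<mu> w \<rho>) z"
    unfolding dz_drho2_def by (rule higher_deriv_cong_ev) simp
  then show ?thesis
    unfolding gen_Gamma_series_def
    using powr_series_euler_sums[OF entire_coeffs_gen_Gamma[OF A r] z, of "x - 2" p \<mu> j] by simp
qed

text \<open>
  Two \<open>\<rho>\<close>-derivatives replace \<open>x\<close> by \<open>x - 2\<close>, which is exactly the effect of
  \<open>k \<rightarrow> k - 1\<close> on the argument \<open>x + 2 k\<close> of the Gamma factor. An Euler operator in
  \<open>z\<close> multiplies the \<open>k\<close>-th term by its characteristic polynomial at the exponent. If this polynomial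
  kills the term \<open>k = 0\<close> and turns \<open>A (k + 1)\<close> into \<open>\<beta> A k\<close>, the shifted sum is \<open>\<beta> z ^ p\<close> times the
  original one.
\<close>

lemma gen_Gamma_series_ode:
  assumes A: "entire_against_fact A" and r: "Re \<rho> > 0" and z: "z \<notin> \<real>\<^sub>\<le>\<^sub>0"
    and F: "\<And>w r. w \<notin> \<real>\<^sub>\<le>\<^sub>0 \<Longrightarrow> Re r > 0 \<Longrightarrow> F w r = gen_Gamma_series A x p \<mu> w r"
    and indicial: "(\<Sum>j\<le>n. q j * falling \<mu> j) = 0"
    and rec: "\<And>k. A (Suc k) * (\<Sum>j\<le>n. q j * falling (exponent p \<mu> (Suc k)) j) = \<beta> * A k"
  shows "(\<Sum>j\<le>n. q j * (z ^ j * dz_drho2 j F z \<rho>)) = \<beta> * z ^ p * F z \<rho>"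
proof -
  have z0: "z \<noteq> 0" using z by auto
  define t where "t k = A k * (\<Sum>j\<le>n. q j * falling (exponent p \<mu> k) j)
      * gen_Gamma \<rho> (x - 2 + 2 * of_nat k) * z powr exponent p \<mu> k" for k
  have "(\<lambda>k. \<Sum>j\<le>n. q j * (A k * gen_Gamma \<rho> (x - 2 + 2 * of_nat k) * falling (exponent p \<mu> k) j
            * z powr exponent p \<mu> k)) sums (\<Sum>j\<le>n. q j * (z ^ j * dz_drho2 j F z \<rho>))"
    by (intro sums_sum sums_mult dz_drho2_sums assms)
  then have t_sums: "t sums (\<Sum>j\<le>n. q j * (z ^ j * dz_drho2 j F z \<rho>))"
    by (simp add: t_def[abs_def] sum_distrib_left sum_distrib_right mult_ac)
  have "t 0 = 0"
    using indicial by (simp add: t_def exponent_def)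
  then have "(\<lambda>k. t (Suc k)) sums (\<Sum>j\<le>n. q j * (z ^ j * dz_drho2 j F z \<rho>))"
    using t_sums sums_Suc_iff[of t] by simp
  moreover have "t (Suc k) = \<beta> * z ^ p * (A k * gen_Gamma \<rho> (x + 2 * of_nat k) * z powr exponent p \<mu> k)" for k
  proof -
    have "x - 2 + 2 * of_nat (Suc k) = x + 2 * of_nat k" by simp
    moreover have "z powr exponent p \<mu> (Suc k) = z ^ p * z powr exponent p \<mu> k"
      using powr_exponent[OF z0, of p \<mu> "Suc k" 0] powr_exponent[OF z0, of p \<mu> k 0] by simp
    ultimately have "t (Suc k) = A (Suc k) * (\<Sum>j\<le>n. q j * falling (exponent p \<mu> (Suc k)) j)
        * gen_Gamma \<rho> (x + 2 * of_nat k) * (z ^ p * z powr exponent p \<mu> k)"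
      by (simp only: t_def)
    then show ?thesis
      unfolding rec by simp
  qed
  moreover have "(\<lambda>k. \<beta> * z ^ p * (A k * gen_Gamma \<rho> (x + 2 * of_nat k) * z powr exponent p \<mu> k))
      sums (\<beta> * z ^ p * F z \<rho>)"
    unfolding F[OF z r] gen_Gamma_series_def
    using summable_powr_exponent[OF entire_coeffs_gen_Gamma[OF A r] z0, of x p \<mu> 0]
    by (intro sums_mult summable_sums) simp
  ultimately show ?thesis
    using sums_unique2 by simp
qed

section \<open>The coefficients of the unified Bessel function\<close>

definition unified_Bessel_coeff :: "complex \<Rightarrow> complex \<Rightarrow> nat \<Rightarrow> complex" where
  "unified_Bessel_coeff \<nu> \<beta> k = \<beta> ^ k / (fact k * Gamma (\<nu> + of_nat k + 1) * Gamma (\<nu> + 2 * of_nat k + 1))"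


lemma Re_pos_not_nonpos_Int:
  fixes s :: complex
  assumes "Re s > 0"
  shows "s \<notin> \<int>\<^sub>\<le>\<^sub>0"
  using assms by (auto elim!: nonpos_Ints_cases)

text \<open>
  The four factors gained by the denominator when \<open>k\<close> increases; they come out in the
  characteristic polynomials of both differential equations. The condition on \<open>\<nu>\<close> keeps the Gamma functions
  away from their poles, where the recurrence could fail.
\<close>

lemma unified_Bessel_coeff_Suc:
  assumes \<nu>: "Re \<nu> > - 1"
  shows "unified_Bessel_coeff \<nu> \<beta> (Suc k) *
      (of_nat (Suc k) * (\<nu> + of_nat k + 1) * (\<nu> + 2 * of_nat k + 1) * (\<nu> + 2 * of_nat k + 2))
      = \<beta> * unified_Bessel_coeff \<nu> \<beta> k"
proof -
  let ?a = "\<nu> + of_nat k + 1" and ?b = "\<nu> + 2 * of_nat k + 1"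
  have pos: "Re ?a > 0" "Re ?b > 0" "Re (?b + 1) > 0"
    using \<nu> by auto
  note np = this[THEN Re_pos_not_nonpos_Int]
  have nz: "?a \<noteq> 0" "?b \<noteq> 0" "?b + 1 \<noteq> 0"
    using np by auto
  have G: "Gamma ?a \<noteq> 0" "Gamma ?b \<noteq> 0"
    using np by (auto simp: Gamma_eq_zero_iff)
  have 1: "Gamma (\<nu> + of_nat (Suc k) + 1) = ?a * Gamma ?a"
    using Gamma_plus1[OF np(1)] by (simp add: add_ac)
  have "Gamma (?b + 1 + 1) = (?b + 1) * (?b * Gamma ?b)"
    using Gamma_plus1[OF np(2)] Gamma_plus1[OF np(3)] by simp
  moreover have "\<nu> + 2 * of_nat (Suc k) + 1 = ?b + 1 + 1"
    by simp
  ultimately have 2: "Gamma (\<nu> + 2 * of_nat (Suc k) + 1) = (?b + 1) * (?b * Gamma ?b)"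
    by metis
  have 3: "\<nu> + 2 * of_nat k + 2 = ?b + 1" by simp
  have 4: "(fact (Suc k) :: complex) = of_nat (Suc k) * fact k"
    by (simp only: fact_Suc)
  have 5: "(of_nat (Suc k) :: complex) \<noteq> 0" by (simp only: of_nat_eq_0_iff nat.distinct simp_thms)
  show ?thesis
    unfolding unified_Bessel_coeff_def 1 2 3 4 power_Suc using nz G 5 by (simp add: divide_simps)
qed

text \<open>
  Ratio test: the denominator gains four factors of size at least \<open>k\<close>, the factorial only two
  of size at most \<open>3 k\<close> once \<open>k \<ge> N + 2\<close>. So the ratio is at most
  \<open>9 |\<beta>| |R| / k\<^sup>2\<close>, which is at most \<open>1 / 2\<close> as soon as \<open>k \<ge> 18 |\<beta>| |R|\<close>.
\<close>

lemma entire_against_fact_unified_Bessel_coeff: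
  assumes \<nu>: "Re \<nu> > - 1"
  shows "entire_against_fact (unified_Bessel_coeff \<nu> \<beta>)"
  unfolding entire_against_fact_def
proof (intro allI)
  fix N :: nat and R :: real
  let ?f = "\<lambda>k. norm (unified_Bessel_coeff \<nu> \<beta> k) * fact (2 * k + N) * R ^ k"
  define M where "M = N + 2 + nat \<lceil>18 * (norm \<beta> * \<bar>R\<bar>)\<rceil>"
  show "summable ?f"
  proof (rule summable_ratio_test[of "1 / 2" M])
    fix k assume "k \<ge> M"
    then have k: "k \<ge> N + 2" "18 * (norm \<beta> * \<bar>R\<bar>) \<le> real k"
      unfolding M_def by linarith+
    define B where "B = (\<lambda>k. norm (unified_Bessel_coeff \<nu> \<beta> k))"
    define D where "D = norm (of_nat (Suc k) * (\<nu> + of_nat k + 1) * (\<nu> + 2 * of_nat k + 1) * (\<nu> + 2 * of_nat k + 2))"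
    have BD: "B (Suc k) * D = norm \<beta> * B k"
      using arg_cong[OF unified_Bessel_coeff_Suc[OF \<nu>, of \<beta> k], of norm]
      unfolding B_def D_def by (simp only: norm_mult)
    have le: "real k \<le> norm s" if "Re s \<ge> real k" for s
      using that complex_Re_le_cmod[of s] by linarith
    have "real k * real k * real k * real k \<le> D"
      unfolding D_def norm_mult
      by (intro mult_mono le mult_nonneg_nonneg) (use \<nu> in \<open>auto simp del: of_nat_Suc simp: of_nat_mono\<close>)
    then have k4: "real k ^ 4 \<le> D" by (simp add: eval_nat_numeral mult_ac)
    have fact_le: "fact (2 * Suc k + N) \<le> 9 * real k ^ 2 * fact (2 * k + N)"
    proof -
      have "fact (2 * Suc k + N) = real (2 * k + N + 2) * real (2 * k + N + 1) * fact (2 * k + N)"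
        by (simp add: algebra_simps)
      also have "\<dots> \<le> (3 * real k) * (3 * real k) * fact (2 * k + N)"
        by (intro mult_right_mono mult_mono) (use k in auto)
      finally show ?thesis by (simp add: power2_eq_square)
    qed
    have "B (Suc k) * fact (2 * Suc k + N) * \<bar>R\<bar> ^ Suc k * real k ^ 4
        \<le> B (Suc k) * fact (2 * Suc k + N) * \<bar>R\<bar> ^ Suc k * D"
      by (intro mult_left_mono k4) (auto simp: B_def)
    also have "\<dots> = (norm \<beta> * \<bar>R\<bar>) * (B k * \<bar>R\<bar> ^ k) * fact (2 * Suc k + N)"
      using BD by (simp add: mult_ac)
    also have "\<dots> \<le> (norm \<beta> * \<bar>R\<bar>) * (B k * \<bar>R\<bar> ^ k) * (9 * real k ^ 2 * fact (2 * k + N))"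
      by (intro mult_left_mono fact_le) (auto simp: B_def)
    also have "\<dots> = (18 * (norm \<beta> * \<bar>R\<bar>)) * (1 / 2 * (B k * fact (2 * k + N) * \<bar>R\<bar> ^ k) * real k ^ 2)"
      by simp
    also have "\<dots> \<le> real k ^ 2 * (1 / 2 * (B k * fact (2 * k + N) * \<bar>R\<bar> ^ k) * real k ^ 2)"
    proof (rule mult_right_mono)
      have "real k \<le> real k ^ 2" using k by (simp add: power2_eq_square)
      then show "18 * (norm \<beta> * \<bar>R\<bar>) \<le> real k ^ 2" using k by linarith
    qed (auto simp: B_def)
    also have "\<dots> = 1 / 2 * (B k * fact (2 * k + N) * \<bar>R\<bar> ^ k) * real k ^ 4"
      by (simp add: power2_eq_square power4_eq_xxxx)
    finally have "B (Suc k) * fact (2 * Suc k + N) * \<bar>R\<bar> ^ Suc k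
        \<le> 1 / 2 * (B k * fact (2 * k + N) * \<bar>R\<bar> ^ k)"
      using k by (subst (asm) mult_le_cancel_right) auto
    then show "norm (?f (Suc k)) \<le> 1 / 2 * norm (?f k)"
      by (simp only: B_def real_norm_def abs_mult power_abs abs_norm_cancel abs_of_nonneg[OF fact_ge_zero])
  qed simp
qed

lemma entire_against_fact_cmult:
  assumes "entire_against_fact A"
  shows "entire_against_fact (\<lambda>k. K * A k)"
  unfolding entire_against_fact_def
proof (intro allI)
  fix N R
  have "summable (\<lambda>k. norm K * (norm (A k) * fact (2 * k + N) * R ^ k))"
    using assms unfolding entire_against_fact_def by (intro summable_mult) blast
  then show "summable (\<lambda>k. norm (K * A k) * fact (2 * k + N) * R ^ k)"
    by (simp add: norm_mult mult_ac)
qed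

lemma gen_Gamma_series_power_form:
  assumes A: "entire_against_fact A" and r: "Re \<rho> > 0" and z: "z \<noteq> 0"
  shows "gen_Gamma_series (\<lambda>k. K * A k) x p \<mu> z \<rho>
      = K * z powr \<mu> * (\<Sum>k. A k * gen_Gamma \<rho> (x + 2 * of_nat k) * (z ^ p) ^ k)"
proof -
  have "summable (\<lambda>k. A k * gen_Gamma \<rho> (x + 2 * of_nat k) * (z ^ p) ^ k)"
    by (intro entire_coeffs_summable entire_coeffs_gen_Gamma A r)
  from suminf_mult[OF this, of "K * z powr \<mu>"] show ?thesis
    unfolding gen_Gamma_series_def using powr_exponent[OF z, of p \<mu> _ 0] by (simp add: mult_ac)
qed

text \<open>
  Substituting \<open>z = 2 v\<close> leaves a power series in \<open>v\<^sup>2\<close>: no power of a product has to be split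
  into principal powers inside the sum, and all branch questions concern the one prefactor \<open>v powr \<nu>\<close>.
\<close>

lemma unified_Bessel_power_form:
  assumes \<nu>: "Re \<nu> > - 1" and r: "Re \<rho> > 0" and v: "v \<noteq> 0"
  shows "unified_Bessel \<nu> b c (2 * v) \<rho> = v powr \<nu> / Gamma c *
      (\<Sum>k. unified_Bessel_coeff \<nu> (- b) k * gen_Gamma \<rho> (c + \<nu> + 2 * of_nat k) * (v ^ 2) ^ k)"
proof -
  have "gen_Gamma_series (\<lambda>k. 1 / Gamma c * unified_Bessel_coeff \<nu> (- b) k) (c + \<nu>) 2 \<nu> v \<rho> = unified_Bessel \<nu> b c (2 * v) \<rho>"
    unfolding gen_Gamma_series_def unified_Bessel_def
    by (simp add: gen_poch_def unified_Bessel_coeff_def exponent_def add_ac mult_ac)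
  then show ?thesis
    using gen_Gamma_series_power_form[OF entire_against_fact_unified_Bessel_coeff[OF \<nu>] r v, of "1 / Gamma c" "- b" "c + \<nu>" 2 \<nu>]
    by simp
qed

text \<open>
  The prefactors cancel since \<open>csqrt z\<close> has half the logarithm of \<open>z\<close>.
\<close>

lemma Bessel_Clifford_eq_gen_Gamma_series:
  assumes \<nu>: "Re \<nu> > - 1" and r: "Re \<rho> > 0" and z: "z \<noteq> 0"
  shows "Bessel_Clifford \<nu> b a z \<rho>
    = gen_Gamma_series (\<lambda>k. 1 / Gamma a * unified_Bessel_coeff \<nu> (- b) k) (a + \<nu>) 1 0 z \<rho>"
proof -
  have "Ln (csqrt z) = Ln z / 2"
  proof -
    have "csqrt z = exp (Ln z / 2)" using z by (rule csqrt_exp_Ln)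
    moreover have "Ln (exp (Ln z / 2)) = Ln z / 2"
      using z mpi_less_Im_Ln[of z] Im_Ln_le_pi[of z] by (intro Ln_exp) auto
    ultimately show ?thesis by simp
  qed
  then have "z powr (- \<nu> / 2) * csqrt z powr \<nu> = exp (- \<nu> / 2 * Ln z) * exp (\<nu> * (Ln z / 2))"
    using z by (simp only: powr_def csqrt_eq_0 if_False)
  also have "\<dots> = exp (- \<nu> / 2 * Ln z + \<nu> * (Ln z / 2))"
    by (rule exp_add[symmetric])
  finally have "z powr (- \<nu> / 2) * csqrt z powr \<nu> = 1"
    by simp
  then show ?thesis
    unfolding Bessel_Clifford_def gen_Gamma_series_power_form[OF entire_against_fact_unified_Bessel_coeff[OF \<nu>] r z]
    using unified_Bessel_power_form[OF \<nu> r, of "csqrt z" b a] z by simp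
qed

text \<open>
  With \<open>v = z / 2\<close>, the square root in the definition is \<open>(sqrt pi / 2) * v powr (- 1 / 2)\<close>, which
  lowers the exponent \<open>\<nu> + 1 / 2\<close> of the prefactor to \<open>\<nu>\<close>; here \<open>z\<close> must avoid the branch cut. The factors
  \<open>1 / 4\<close> from \<open>v\<^sup>2 = z\<^sup>2 / 4\<close> are absorbed into the parameter \<open>- b / 4\<close>.
\<close>

lemma spherical_Bessel_eq_gen_Gamma_series:
  fixes \<nu> :: complex
  assumes \<nu>: "Re \<nu> > - 3 / 2" and r: "Re \<rho> > 0" and z: "z \<notin> \<real>\<^sub>\<le>\<^sub>0"
  shows "spherical_Bessel \<nu> b c z \<rho>
    = gen_Gamma_series (\<lambda>k. complex_of_real (sqrt pi / 2) * (1 / 2) powr \<nu> / Gamma (c - 1 / 2) * unified_Bessel_coeff (\<nu> + 1 / 2) (- b / 4) k)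
        (c + \<nu>) 2 \<nu> z \<rho>"
proof -
  have z0: "z \<noteq> 0" using z by auto
  have \<nu>': "Re (\<nu> + 1 / 2) > - 1" using \<nu> by simp
  define v where "v = z / 2"
  have v0: "v \<noteq> 0" using z0 by (simp add: v_def)
  have vp: "v powr \<nu> = (1 / 2) powr \<nu> * z powr \<nu>"
    using powr_times_real_left[of "1 / 2" z \<nu>] by (simp add: v_def)
  have v: "v \<notin> \<real>\<^sub>\<le>\<^sub>0"
    using z by (auto simp: v_def complex_nonpos_Reals_iff)
  have "csqrt (of_real pi / (2 * z)) = csqrt (of_real (pi / 4) * inverse v)"
    by (simp add: v_def field_simps)
  also have "\<dots> = (of_real (pi / 4) * inverse v) powr (1 / 2)"
    by (rule csqrt_conv_powr)
  also have "\<dots> = of_real (pi / 4) powr (1 / 2) * inverse v powr (1 / 2)"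
    by (rule powr_times_real_left) auto
  also have "of_real (pi / 4) powr (1 / 2) = complex_of_real (sqrt pi / 2)"
    by (subst csqrt_conv_powr[symmetric], subst csqrt_of_real) (auto simp: real_sqrt_divide)
  also have "inverse v powr (1 / 2) = v powr (- (1 / 2))"
    using v v0 by (simp add: powr_def Ln_inverse)
  finally have "csqrt (of_real pi / (2 * z)) * v powr (\<nu> + 1 / 2)
      = of_real (sqrt pi / 2) * (v powr (- (1 / 2)) * v powr (\<nu> + 1 / 2))"
    by (simp only: mult.assoc)
  also have "\<dots> = of_real (sqrt pi / 2) * v powr \<nu>"
    by (simp flip: powr_add)
  finally have prefactor:
    "csqrt (of_real pi / (2 * z)) * v powr (\<nu> + 1 / 2) = of_real (sqrt pi / 2) * v powr \<nu>" .
  have series: "spherical_Bessel \<nu> b c z \<rho> = csqrt (of_real pi / (2 * z)) * v powr (\<nu> + 1 / 2) / Gamma (c - 1 / 2)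
      * (\<Sum>k. unified_Bessel_coeff (\<nu> + 1 / 2) (- b) k * gen_Gamma \<rho> (c + \<nu> + 2 * of_nat k) * (v ^ 2) ^ k)"
    using unified_Bessel_power_form[OF \<nu>' r v0, of b "c - 1 / 2"] by (simp add: spherical_Bessel_def v_def)
  have coeff: "unified_Bessel_coeff (\<nu> + 1 / 2) (- b) k * gen_Gamma \<rho> (c + \<nu> + 2 * of_nat k) * (v ^ 2) ^ k
      = unified_Bessel_coeff (\<nu> + 1 / 2) (- b / 4) k * gen_Gamma \<rho> (c + \<nu> + 2 * of_nat k) * (z ^ 2) ^ k" for k
  proof -
    have "- b * v ^ 2 = - b / 4 * z ^ 2"
      by (simp add: v_def power_divide)
    then have "(- b) ^ k * (v ^ 2) ^ k = (- b / 4) ^ k * (z ^ 2) ^ k"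
      by (metis power_mult_distrib)
    then show ?thesis by (simp add: unified_Bessel_coeff_def)
  qed
  show ?thesis
    unfolding gen_Gamma_series_power_form[OF entire_against_fact_unified_Bessel_coeff[OF \<nu>'] r z0]
      series prefactor coeff vp
    by (simp only: times_divide_eq_left mult.assoc)
qed

section \<open>The differential equations\<close>

lemma falling_simps:
  "falling e 0 = 1"
  "falling e 1 = e"
  "falling e 2 = e * (e - 1)"
  "falling e 3 = e * (e - 1) * (e - 2)"
  "falling e 4 = e * (e - 1) * (e - 2) * (e - 3)"
  by (simp_all add: falling_def eval_nat_numeral)

lemma sum_atMost_4: "(\<Sum>j\<le>4. f j) = f 0 + f 1 + f 2 + f 3 + f (4::nat)" for f :: "nat \<Rightarrow> complex"
  by (simp add: eval_nat_numeral)

text \<open>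
  The characteristic polynomial is \<open>(e - \<nu>) (e + \<nu> + 1) (2 e - 1) (2 e + 1)\<close>. It vanishes at
  \<open>e = \<nu>\<close>, and at \<open>e = 2 (k + 1) + \<nu>\<close> it is \<open>16\<close> times the four factors of
  \<open>unified_Bessel_coeff_Suc\<close> with \<open>\<nu> + 1 / 2\<close> in place of \<open>\<nu>\<close>. Together with the parameter
  \<open>- b / 4\<close> this gives the constant \<open>- 4 b\<close>.
\<close>

lemma spherical_Bessel_pde:
  assumes \<rho>: "Re \<rho> > 0" and z: "z \<notin> \<real>\<^sub>\<le>\<^sub>0" and \<nu>: "Re \<nu> > - 3 / 2"
  shows "derivs_exist (spherical_Bessel \<nu> b c)"
    and "(- 4 * \<nu>^2 - 4 * \<nu> + 6) * z * dz_drho2 1 (spherical_Bessel \<nu> b c) z \<rho>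
        + (- 4 * \<nu>^2 - 4 * \<nu> + 39) * z^2 * dz_drho2 2 (spherical_Bessel \<nu> b c) z \<rho>
        + 28 * z^3 * dz_drho2 3 (spherical_Bessel \<nu> b c) z \<rho>
        + 4 * z^4 * dz_drho2 4 (spherical_Bessel \<nu> b c) z \<rho>
        + (\<nu>^2 + \<nu>) * dz_drho2 0 (spherical_Bessel \<nu> b c) z \<rho>
        = - 4 * b * z^2 * spherical_Bessel \<nu> b c z \<rho>"
proof -
  have \<nu>': "Re (\<nu> + 1 / 2) > - 1" using \<nu> by simp
  define K where "K = complex_of_real (sqrt pi / 2) * (1 / 2) powr \<nu> / Gamma (c - 1 / 2)"
  define A where "A k = K * unified_Bessel_coeff (\<nu> + 1 / 2) (- b / 4) k" for k
  have A: "entire_against_fact A"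
    unfolding A_def[abs_def] by (intro entire_against_fact_cmult entire_against_fact_unified_Bessel_coeff \<nu>')
  have F: "spherical_Bessel \<nu> b c w r = gen_Gamma_series A (c + \<nu>) 2 \<nu> w r"
    if "w \<notin> \<real>\<^sub>\<le>\<^sub>0" "Re r > 0" for w r
    unfolding A_def[abs_def] K_def using spherical_Bessel_eq_gen_Gamma_series[OF \<nu> that(2,1)] by simp
  show "derivs_exist (spherical_Bessel \<nu> b c)"
    by (rule derivs_exist_gen_Gamma_series[OF A F])
  define q where "q j = [\<nu>^2 + \<nu>, - 4 * \<nu>^2 - 4 * \<nu> + 6, - 4 * \<nu>^2 - 4 * \<nu> + 39, 28, 4] ! j" for j
  have q: "q 0 = \<nu>^2 + \<nu>" "q 1 = - 4 * \<nu>^2 - 4 * \<nu> + 6" "q 2 = - 4 * \<nu>^2 - 4 * \<nu> + 39" "q 3 = 28" "q 4 = 4"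
    by (simp_all add: q_def eval_nat_numeral)
  have P: "(\<Sum>j\<le>4. q j * falling e j) = (e - \<nu>) * (e + \<nu> + 1) * (2 * e - 1) * (2 * e + 1)" for e
    unfolding sum_atMost_4 q falling_simps by algebra
  have rec: "A (Suc k) * (\<Sum>j\<le>4. q j * falling (exponent 2 \<nu> (Suc k)) j) = - 4 * b * A k" for k
  proof -
    have "(\<Sum>j\<le>4. q j * falling (exponent 2 \<nu> (Suc k)) j) = 16 * (of_nat (Suc k) * (\<nu> + 1 / 2 + of_nat k + 1)
        * (\<nu> + 1 / 2 + 2 * of_nat k + 1) * (\<nu> + 1 / 2 + 2 * of_nat k + 2))"
      unfolding P exponent_def by (simp add: field_simps)
    then have "A (Suc k) * (\<Sum>j\<le>4. q j * falling (exponent 2 \<nu> (Suc k)) j)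
        = 16 * K * (unified_Bessel_coeff (\<nu> + 1 / 2) (- b / 4) (Suc k) * (of_nat (Suc k) * (\<nu> + 1 / 2 + of_nat k + 1)
        * (\<nu> + 1 / 2 + 2 * of_nat k + 1) * (\<nu> + 1 / 2 + 2 * of_nat k + 2)))"
      by (simp only: A_def mult_ac)
    then show ?thesis
      unfolding unified_Bessel_coeff_Suc[OF \<nu>'] by (simp add: A_def)
  qed
  have "(\<Sum>j\<le>4. q j * (z ^ j * dz_drho2 j (spherical_Bessel \<nu> b c) z \<rho>))
      = - 4 * b * z ^ 2 * spherical_Bessel \<nu> b c z \<rho>"
    by (rule gen_Gamma_series_ode[OF A \<rho> z F _ rec]) (simp_all add: P)
  then show "(- 4 * \<nu>^2 - 4 * \<nu> + 6) * z * dz_drho2 1 (spherical_Bessel \<nu> b c) z \<rho>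
        + (- 4 * \<nu>^2 - 4 * \<nu> + 39) * z^2 * dz_drho2 2 (spherical_Bessel \<nu> b c) z \<rho>
        + 28 * z^3 * dz_drho2 3 (spherical_Bessel \<nu> b c) z \<rho>
        + 4 * z^4 * dz_drho2 4 (spherical_Bessel \<nu> b c) z \<rho>
        + (\<nu>^2 + \<nu>) * dz_drho2 0 (spherical_Bessel \<nu> b c) z \<rho>
        = - 4 * b * z^2 * spherical_Bessel \<nu> b c z \<rho>"
    unfolding sum_atMost_4 q by (simp only: mult.assoc power_0 power_one_right mult_1_left add_ac)
qed

text \<open>
  The characteristic polynomial is \<open>e (\<nu> + e) (\<nu> + 2 e - 1) (\<nu> + 2 e)\<close>, which vanishes at \<open>e = 0\<close> and
  consists of the four factors of \<open>unified_Bessel_coeff_Suc\<close> at \<open>e = k + 1\<close>. The Euler form of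
  the equation is \<open>z\<close> times the stated one.
\<close>

lemma Bessel_Clifford_pde:
  assumes \<rho>: "Re \<rho> > 0" and z: "z \<notin> \<real>\<^sub>\<le>\<^sub>0" and \<nu>: "Re \<nu> > - 1"
  shows "derivs_exist (Bessel_Clifford \<nu> b a)"
    and "(\<nu>^3 + 4 * \<nu>^2 + 5 * \<nu> + 2) * dz_drho2 1 (Bessel_Clifford \<nu> b a) z \<rho>
        + (5 * \<nu>^2 + 21 * \<nu> + 22) * z * dz_drho2 2 (Bessel_Clifford \<nu> b a) z \<rho>
        + (8 * \<nu> + 22) * z^2 * dz_drho2 3 (Bessel_Clifford \<nu> b a) z \<rho>
        + 4 * z^3 * dz_drho2 4 (Bessel_Clifford \<nu> b a) z \<rho>
        = - b * Bessel_Clifford \<nu> b a z \<rho>" (is "?L = ?R")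
proof -
  define A where "A k = 1 / Gamma a * unified_Bessel_coeff \<nu> (- b) k" for k
  have A: "entire_against_fact A"
    unfolding A_def[abs_def] by (intro entire_against_fact_cmult entire_against_fact_unified_Bessel_coeff \<nu>)
  have F: "Bessel_Clifford \<nu> b a w r = gen_Gamma_series A (a + \<nu>) 1 0 w r"
    if "w \<notin> \<real>\<^sub>\<le>\<^sub>0" "Re r > 0" for w r
    unfolding A_def[abs_def] by (rule Bessel_Clifford_eq_gen_Gamma_series[OF \<nu> that(2)]) (use that in auto)
  show "derivs_exist (Bessel_Clifford \<nu> b a)"
    by (rule derivs_exist_gen_Gamma_series[OF A F])
  define q where "q j = [0, \<nu>^3 + 4 * \<nu>^2 + 5 * \<nu> + 2, 5 * \<nu>^2 + 21 * \<nu> + 22, 8 * \<nu> + 22, 4] ! j" for j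
  have q: "q 0 = 0" "q 1 = \<nu>^3 + 4 * \<nu>^2 + 5 * \<nu> + 2" "q 2 = 5 * \<nu>^2 + 21 * \<nu> + 22" "q 3 = 8 * \<nu> + 22" "q 4 = 4"
    by (simp_all add: q_def eval_nat_numeral)
  have P: "(\<Sum>j\<le>4. q j * falling e j) = e * (\<nu> + e) * (\<nu> + 2 * e - 1) * (\<nu> + 2 * e)" for e
    unfolding sum_atMost_4 q falling_simps by algebra
  have rec: "A (Suc k) * (\<Sum>j\<le>4. q j * falling (exponent 1 0 (Suc k)) j) = - b * A k" for k
  proof -
    have "(\<Sum>j\<le>4. q j * falling (exponent 1 0 (Suc k)) j) = of_nat (Suc k) * (\<nu> + of_nat k + 1)
        * (\<nu> + 2 * of_nat k + 1) * (\<nu> + 2 * of_nat k + 2)"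
      unfolding P exponent_def by (simp add: algebra_simps)
    then have "A (Suc k) * (\<Sum>j\<le>4. q j * falling (exponent 1 0 (Suc k)) j)
        = 1 / Gamma a * (unified_Bessel_coeff \<nu> (- b) (Suc k) * (of_nat (Suc k) * (\<nu> + of_nat k + 1)
        * (\<nu> + 2 * of_nat k + 1) * (\<nu> + 2 * of_nat k + 2)))"
      by (simp only: A_def mult_ac)
    then show ?thesis
      unfolding unified_Bessel_coeff_Suc[OF \<nu>] by (simp add: A_def)
  qed
  have "(\<Sum>j\<le>4. q j * (z ^ j * dz_drho2 j (Bessel_Clifford \<nu> b a) z \<rho>))
      = - b * z ^ 1 * Bessel_Clifford \<nu> b a z \<rho>"
    by (rule gen_Gamma_series_ode[OF A \<rho> z F _ rec]) (simp_all add: P)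
  then have "z * ?L = z * ?R"
    unfolding sum_atMost_4 q by (simp add: eval_nat_numeral algebra_simps)
  moreover have "z \<noteq> 0" using z by auto
  ultimately show "?L = ?R" by (simp only: mult_cancel_left simp_thms)
qed

theorem theorem6p12:
  fixes b \<rho> z :: complex
  assumes "Re \<rho> > 0" and "z \<notin> \<real>\<^sub>\<le>\<^sub>0"
  shows
    "(\<forall>\<nu> c :: complex. Re \<nu> > - 3 / 2 \<longrightarrow> Re c > 1 / 2 \<longrightarrow>
        derivs_exist (spherical_Bessel \<nu> b c) \<and>
        (- 4 * \<nu>^2 - 4 * \<nu> + 6) * z * dz_drho2 1 (spherical_Bessel \<nu> b c) z \<rho>
        + (- 4 * \<nu>^2 - 4 * \<nu> + 39) * z^2 * dz_drho2 2 (spherical_Bessel \<nu> b c) z \<rho>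
        + 28 * z^3 * dz_drho2 3 (spherical_Bessel \<nu> b c) z \<rho>
        + 4 * z^4 * dz_drho2 4 (spherical_Bessel \<nu> b c) z \<rho>
        + (\<nu>^2 + \<nu>) * dz_drho2 0 (spherical_Bessel \<nu> b c) z \<rho>
        = - 4 * b * z^2 * spherical_Bessel \<nu> b c z \<rho>)
     \<and>
     (\<forall>\<nu> a :: complex. Re \<nu> > - 1 \<longrightarrow> Re a > 0 \<longrightarrow>
        derivs_exist (Bessel_Clifford \<nu> b a) \<and>
        (\<nu>^3 + 4 * \<nu>^2 + 5 * \<nu> + 2) * dz_drho2 1 (Bessel_Clifford \<nu> b a) z \<rho>
        + (5 * \<nu>^2 + 21 * \<nu> + 22) * z * dz_drho2 2 (Bessel_Clifford \<nu> b a) z \<rho>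
        + (8 * \<nu> + 22) * z^2 * dz_drho2 3 (Bessel_Clifford \<nu> b a) z \<rho>
        + 4 * z^3 * dz_drho2 4 (Bessel_Clifford \<nu> b a) z \<rho>
        = - b * Bessel_Clifford \<nu> b a z \<rho>)"
  using spherical_Bessel_pde[OF assms] Bessel_Clifford_pde[OF assms] by blast

end
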